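(* For $f\in \mathrm{bmo}(\mathbb{R}^n)$, the following are equivalent: (i) $f$ is in the closure of $\mathrm{bmo}_c(\mathbb{R}^n)$ in $\mathrm{bmo}(\mathbb{R}^n)$; (ii) $f$ vanishes at infinity, i.e. $\lim_{R\to\infty}\|f\|_{\mathrm{bmo}(\mathbb{R}^n\setminus\overline{B(0,R)})}=0$; (iii) $\lim_{\beta\to\infty}\gamma(f,\beta)=0$, where $$\gamma(f,\beta) := \sup_{\mathrm{dist}(Q,0)>\beta,\ \ell(Q)<1}\frac{1}{|Q|}\int_Q|f-f_Q| + \sup_{\mathrm{dist}(Q,0)>\beta,\ \ell(Q)=1}|f|_Q;$$ (iv) $$\lim_{\beta\to\infty}\left(\sup_{\mathrm{dist}(Q,0)>\beta,\ \ell(Q)<1}\frac{1}{|Q|}\int_Q|f-f_Q| + \sup_{\mathrm{dist}(Q,0)>\beta,\ \ell(Q)\le1}|f|_Q\,\ell(Q)\right)=0.$$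
   Context: All cubes $Q\subset\mathbb{R}^n$ have sides parallel to the axes; $\ell(Q)$ is the sidelength, $f_Q=\frac{1}{|Q|}\int_Qf$, and $|f|_Q$ is the average of $|f|$ over $Q$. For an open set $U\subset\mathbb{R}^n$, a function $f$ integrable on every cube $Q\subset U$ has $$\|f\|_{\mathrm{bmo}(U)} := \sup_{Q\subset U,\ \ell(Q)<1}\frac{1}{|Q|}\int_Q|f-f_Q| + \sup_{Q\subset U,\ \ell(Q)\ge1}|f|_Q,$$ and $\mathrm{bmo}(U)$ consists of those $f$ for which this is finite; in particular this defines $\mathrm{bmo}(\mathbb{R}^n)$ and its norm. $\mathrm{bmo}_c(\mathbb{R}^n)$ is the subspace of functions in $\mathrm{bmo}(\mathbb{R}^n)$ with compact support. $B(0,R)$ is the Euclidean ball. *)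

theory Defs
  imports "HOL-Analysis.Analysis"
begin

text \<open>Cubes are closed and nondegenerate: a cube is \<open>cube a l\<close> with \<open>l > 0\<close>, where \<open>a\<close> is its
  lowest corner and \<open>l\<close> its sidelength. Both are determined by the cube, so a supremum over
  pairs \<open>(a, l)\<close> is a supremum over cubes.\<close>

definition cube :: "'a::euclidean_space \<Rightarrow> real \<Rightarrow> 'a set" where
  "cube a l = cbox a (a + l *\<^sub>R One)"

definition avg :: "'a::euclidean_space set \<Rightarrow> ('a \<Rightarrow> real) \<Rightarrow> real" where
  "avg Q f = (1 / measure lebesgue Q) * (LINT x:Q|lebesgue. f x)"

definition mean_osc :: "'a::euclidean_space set \<Rightarrow> ('a \<Rightarrow> real) \<Rightarrow> real" where
  "mean_osc Q f = avg Q (\<lambda>x. \<bar>f x - avg Q f\<bar>)"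

text \<open>Suprema are taken in \<open>[0, \<infinity>]\<close>; in particular a supremum over no cubes is \<open>0\<close>. The norm is
  only meaningful for functions integrable on every cube in \<open>U\<close>; this is required in \<open>bmo\<close>.\<close>

definition bmo_norm :: "'a::euclidean_space set \<Rightarrow> ('a \<Rightarrow> real) \<Rightarrow> ennreal" where
  "bmo_norm U f =
     (SUP (a, l) \<in> {(a, l). 0 < l \<and> l < 1 \<and> cube a l \<subseteq> U}. ennreal (mean_osc (cube a l) f))
   + (SUP (a, l) \<in> {(a, l). 1 \<le> l \<and> cube a l \<subseteq> U}. ennreal (avg (cube a l) (\<lambda>x. \<bar>f x\<bar>)))"

definition bmo :: "'a::euclidean_space set \<Rightarrow> ('a \<Rightarrow> real) set" where
  "bmo U = {f. (\<forall>a l. 0 < l \<and> cube a l \<subseteq> U \<longrightarrow> f absolutely_integrable_on cube a l)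
               \<and> bmo_norm U f < \<infinity>}"

text \<open>Since functions are identified when they agree almost everywhere, the support is the
  essential one: the complement of the largest open set on which \<open>f\<close> vanishes almost everywhere.\<close>

definition ess_support :: "('a::euclidean_space \<Rightarrow> real) \<Rightarrow> 'a set" where
  "ess_support f = - \<Union>{V. open V \<and> (AE x\<in>V in lebesgue. f x = 0)}"

definition bmo_c :: "('a::euclidean_space \<Rightarrow> real) set" where
  "bmo_c = {f \<in> bmo UNIV. compact (ess_support f)}"

text \<open>Closure in \<open>bmo UNIV\<close> for the distance \<open>bmo_norm UNIV (f - g)\<close>. Elements here are functions
  rather than classes modulo null sets, so this is a pseudometric.\<close>

definition bmo_closure :: "('a::euclidean_space \<Rightarrow> real) set \<Rightarrow> ('a \<Rightarrow> real) set" where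
  "bmo_closure S =
     {f \<in> bmo UNIV. \<forall>\<epsilon>>0. \<exists>g\<in>S. bmo_norm UNIV (\<lambda>x. f x - g x) < ennreal \<epsilon>}"

definition gamma :: "('a::euclidean_space \<Rightarrow> real) \<Rightarrow> real \<Rightarrow> ennreal" where
  "gamma f \<beta> =
     (SUP (a, l) \<in> {(a, l). 0 < l \<and> l < 1 \<and> infdist 0 (cube a l) > \<beta>}.
        ennreal (mean_osc (cube a l) f))
   + (SUP (a, l) \<in> {(a, l). l = 1 \<and> infdist 0 (cube a l) > \<beta>}.
        ennreal (avg (cube a l) (\<lambda>x. \<bar>f x\<bar>)))"

definition gamma_weighted :: "('a::euclidean_space \<Rightarrow> real) \<Rightarrow> real \<Rightarrow> ennreal" where
  "gamma_weighted f \<beta> =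
     (SUP (a, l) \<in> {(a, l). 0 < l \<and> l < 1 \<and> infdist 0 (cube a l) > \<beta>}.
        ennreal (mean_osc (cube a l) f))
   + (SUP (a, l) \<in> {(a, l). 0 < l \<and> l \<le> 1 \<and> infdist 0 (cube a l) > \<beta>}.
        ennreal (avg (cube a l) (\<lambda>x. \<bar>f x\<bar>) * l))"

end

theory Submission imports Defs begin

text \<open>A cube of side at least 1 is reached from unit cubes by repeated bisection, so averages over
  unit cubes far from the origin control averages over all larger cubes there; this gives (iii)
  \<open>\<Longrightarrow>\<close> (ii). For (iii) \<open>\<Longrightarrow>\<close> (iv), doubling a small cube increases the average of \<open>\<bar>f\<bar>\<close> by at most
  a constant times the oscillation, so the average grows at most logarithmically as the side \<open>l\<close>
  shrinks, which the weight \<open>l\<close> absorbs. The same weighted bound is what makes multiplication by a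
  Lipschitz cutoff \<open>\<eta>\<close> harmless: on a cube \<open>Q\<close> of side \<open>l < 1\<close> with corner \<open>a\<close>,
  \<open>\<eta> f - \<eta>(a) f\<^sub>Q = \<eta> (f - f\<^sub>Q) + (\<eta> - \<eta>(a)) f\<^sub>Q\<close>, and the last term is of size \<open>l \<bar>f\<bar>\<^sub>Q\<close>. Hence
  cutting \<open>f\<close> off outside a large ball approximates it in bmo, (iii) \<open>\<Longrightarrow>\<close> (i).\<close>

section \<open>Cubes and averages\<close>

lemma mem_cube: "x \<in> cube a l \<longleftrightarrow> (\<forall>i\<in>Basis. a \<bullet> i \<le> x \<bullet> i \<and> x \<bullet> i \<le> a \<bullet> i + l)"
  by (simp add: cube_def mem_box inner_add_left)

lemma lmeasurable_cube [simp]: "cube a l \<in> lmeasurable"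
  by (simp add: cube_def)

lemma sets_cube [simp]: "cube a l \<in> sets lebesgue"
  by (simp add: fmeasurableD)

lemma measure_cube [simp]:
  fixes a :: "'a::euclidean_space"
  shows "0 \<le> l \<Longrightarrow> measure lebesgue (cube a l) = l ^ DIM('a)"
  by (simp add: cube_def content_cbox_if box_eq_empty inner_add_left)

lemma corner_in_cube: "0 \<le> l \<Longrightarrow> a \<in> cube a l"
  by (simp add: mem_cube)

lemma cube_mono: "l \<le> m \<Longrightarrow> cube a l \<subseteq> cube a m"
  by (fastforce simp: mem_cube)

lemma norm_diff_corner_le:
  fixes a :: "'a::euclidean_space"
  assumes "x \<in> cube a l" "0 \<le> l"
  shows "norm (x - a) \<le> l * norm (One :: 'a)"
proof -
  have "norm (x - a) \<le> norm (l *\<^sub>R (One :: 'a))"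
    by (rule norm_le_componentwise) (use assms in \<open>auto simp: mem_cube inner_diff_left\<close>)
  then show ?thesis using assms by simp
qed

text \<open>A cube is closed and nonempty, so its distance from the origin is attained at one of its
  points; this keeps the inequality strict.\<close>

lemma less_infdist_cube:
  fixes a :: "'a::euclidean_space"
  assumes "0 \<le> l"
  shows "\<beta> < infdist 0 (cube a l) \<longleftrightarrow> (\<forall>x\<in>cube a l. \<beta> < norm x)"
proof
  show "\<forall>x\<in>cube a l. \<beta> < norm x" if "\<beta> < infdist 0 (cube a l)"
    using that infdist_le[of _ "cube a l" 0] by fastforce
  have "closed (cube a l)" "cube a l \<noteq> {}"
    using corner_in_cube[OF assms] by (auto simp: cube_def closed_cbox)
  then show "\<beta> < infdist 0 (cube a l)" if "\<forall>x\<in>cube a l. \<beta> < norm x"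
    using that by (metis infdist_attains_inf dist_0_norm)
qed

text \<open>The set \<open>S\<close> names the coordinates in which a subcube of side
  \<open>s\<close> is pushed to the upper end of the cube. Since \<open>s\<close> is at least half
  of \<open>l\<close>, these subcubes cover; they may overlap, so for nonnegative \<open>g\<close>
  only an inequality results. Both plain bisection (\<open>s = l / 2\<close>) and covering by unit
  cubes (\<open>s = 1\<close>, \<open>l\<close> at most 2) are instances.\<close>

lemma integral_subdivide_le:
  fixes a :: "'a::euclidean_space" and g :: "'a \<Rightarrow> real"
  assumes int: "g absolutely_integrable_on cube a l" and nonneg: "\<And>x. 0 \<le> g x"
    and s: "l / 2 \<le> s" "s \<le> l" "0 < l"
  shows "(LINT x:cube a l|lebesgue. g x)
       \<le> (\<Sum>S\<in>Pow Basis. LINT x:cube (a + (l - s) *\<^sub>R \<Sum>S) s|lebesgue. g x)"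
    and "S \<subseteq> Basis \<Longrightarrow> cube (a + (l - s) *\<^sub>R \<Sum>S) s \<subseteq> cube a l"
proof -
  define q where "q S = cube (a + (l - s) *\<^sub>R \<Sum>S) s" for S :: "'a set"
  have coord: "\<Sum>S \<bullet> i = (if i \<in> S then 1 else 0)" if "S \<subseteq> Basis" "i \<in> Basis" for S and i :: 'a
  proof -
    have "\<Sum>S \<bullet> i = (\<Sum>j\<in>S. if j = i then 1 else 0)"
      unfolding inner_sum_left by (rule sum.cong) (use that in \<open>auto simp: inner_Basis\<close>)
    also have "\<dots> = (if i \<in> S then 1 else 0)"
      using finite_subset[OF that(1) finite_Basis] by simp
    finally show ?thesis .
  qed
  have sub: "q S \<subseteq> cube a l" if "S \<subseteq> Basis" for S
  proof
    fix x assume x: "x \<in> q S"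
    show "x \<in> cube a l"
      unfolding mem_cube
    proof
      fix i :: 'a assume i: "i \<in> Basis"
      show "a \<bullet> i \<le> x \<bullet> i \<and> x \<bullet> i \<le> a \<bullet> i + l"
        using x i s coord[OF that i]
        by (auto simp: q_def mem_cube inner_add_left split: if_splits dest!: bspec[OF _ i])
    qed
  qed
  have cover: "\<exists>S\<in>Pow Basis. x \<in> q S" if x: "x \<in> cube a l" for x
  proof
    \<comment> \<open>In the coordinates of \<open>S\<close> the point is too high for the lower
      position, and \<open>l - s \<le> s\<close> makes the upper position contain it.\<close>
    define S where "S = {i \<in> Basis. a \<bullet> i + s < x \<bullet> i}"
    then show S: "S \<in> Pow Basis" by auto
    show "x \<in> q S"
      unfolding q_def mem_cube
    proof
      fix i :: 'a assume i: "i \<in> Basis"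
      show "(a + (l - s) *\<^sub>R \<Sum>S) \<bullet> i \<le> x \<bullet> i \<and> x \<bullet> i \<le> (a + (l - s) *\<^sub>R \<Sum>S) \<bullet> i + s"
        using x i s coord[of S i] S by (auto simp: S_def mem_cube inner_add_left)
    qed
  qed
  have intq: "set_integrable lebesgue (q S) g" if "S \<in> Pow Basis" for S
    by (rule set_integrable_subset[OF int]) (use sub that in \<open>auto simp: q_def\<close>)
  have "(LINT x:cube a l|lebesgue. g x)
      \<le> (LINT x|lebesgue. (\<Sum>S\<in>Pow Basis. indicat_real (q S) x *\<^sub>R g x))"
    unfolding set_lebesgue_integral_def
  proof (rule Bochner_Integration.integral_mono)
    show "integrable lebesgue (\<lambda>x. indicat_real (cube a l) x *\<^sub>R g x)"
      using int by (simp add: set_integrable_def)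
    show "integrable lebesgue (\<lambda>x. \<Sum>S\<in>Pow Basis. indicat_real (q S) x *\<^sub>R g x)"
      using intq by (intro Bochner_Integration.integrable_sum) (simp add: set_integrable_def)
    fix x
    have nn: "0 \<le> indicat_real (q S) x *\<^sub>R g x" for S by (simp add: nonneg)
    show "indicat_real (cube a l) x *\<^sub>R g x \<le> (\<Sum>S\<in>Pow Basis. indicat_real (q S) x *\<^sub>R g x)"
    proof (cases "x \<in> cube a l")
      case True
      then obtain S where S: "S \<in> Pow Basis" "x \<in> q S" using cover by auto
      have "indicat_real (q S) x *\<^sub>R g x \<le> (\<Sum>S\<in>Pow Basis. indicat_real (q S) x *\<^sub>R g x)"
        by (rule member_le_sum[OF S(1) nn]) simp
      then show ?thesis using True S by simp
    qed (simp add: nonneg)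
  qed
  also have "\<dots> = (\<Sum>S\<in>Pow Basis. LINT x:q S|lebesgue. g x)"
    unfolding set_lebesgue_integral_def
    using intq by (intro Bochner_Integration.integral_sum) (simp add: set_integrable_def)
  finally show "(LINT x:cube a l|lebesgue. g x)
       \<le> (\<Sum>S\<in>Pow Basis. LINT x:cube (a + (l - s) *\<^sub>R \<Sum>S) s|lebesgue. g x)"
    by (simp add: q_def)
  show "S \<subseteq> Basis \<Longrightarrow> cube (a + (l - s) *\<^sub>R \<Sum>S) s \<subseteq> cube a l"
    using sub by (simp add: q_def)
qed

section \<open>Averages and mean oscillation over one set\<close>

lemma avg_mono_AE:
  assumes "f absolutely_integrable_on Q" "g absolutely_integrable_on Q" "AE x\<in>Q in lebesgue. f x \<le> g x"
  shows "avg Q f \<le> avg Q g"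
  unfolding avg_def by (intro mult_left_mono set_integral_mono_AE assms) auto

lemma avg_mono:
  assumes "f absolutely_integrable_on Q" "g absolutely_integrable_on Q" "\<And>x. x \<in> Q \<Longrightarrow> f x \<le> g x"
  shows "avg Q f \<le> avg Q g"
  using assms by (intro avg_mono_AE) auto

lemma avg_cong_AE:
  assumes "f absolutely_integrable_on Q" "g absolutely_integrable_on Q" "AE x\<in>Q in lebesgue. f x = g x"
  shows "avg Q f = avg Q g"
  using assms by (intro antisym avg_mono_AE) (auto elim: eventually_mono)

lemma avg_add:
  assumes "f absolutely_integrable_on Q" "g absolutely_integrable_on Q"
  shows "avg Q (\<lambda>x. f x + g x) = avg Q f + avg Q g"
  using assms by (simp add: avg_def distrib_left add_divide_distrib)

lemma avg_diff:
  assumes "f absolutely_integrable_on Q" "g absolutely_integrable_on Q"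
  shows "avg Q (\<lambda>x. f x - g x) = avg Q f - avg Q g"
  using assms by (simp add: avg_def right_diff_distrib diff_divide_distrib)

lemma avg_const [simp]:
  assumes "0 < l"
  shows "avg (cube a l) (\<lambda>_. c) = c"
proof -
  have "(LINT x:cube a l|lebesgue. c) = measure lebesgue (cube a l) *\<^sub>R c"
    by (rule set_integral_const) (use fmeasurableD2[OF lmeasurable_cube] in auto)
  then show ?thesis using assms by (simp add: avg_def)
qed

lemma avg_nonneg: "(\<And>x. x \<in> Q \<Longrightarrow> 0 \<le> g x) \<Longrightarrow> 0 \<le> avg Q g"
  unfolding avg_def set_lebesgue_integral_def
  by (intro mult_nonneg_nonneg Bochner_Integration.integral_nonneg) (auto simp: indicator_def)

lemma abs_avg_le:
  assumes "f absolutely_integrable_on Q"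
  shows "\<bar>avg Q f\<bar> \<le> avg Q (\<lambda>x. \<bar>f x\<bar>)"
proof -
  have "\<bar>LINT x:Q|lebesgue. f x\<bar> \<le> (LINT x:Q|lebesgue. \<bar>f x\<bar>)"
    using set_integral_norm_bound[OF assms] by simp
  then show ?thesis by (simp add: avg_def abs_mult divide_right_mono)
qed

text \<open>The integral of a nonnegative function grows with the cube, and the factor is the ratio
  of the two volumes.\<close>

lemma avg_subcube_le:
  fixes a b :: "'a::euclidean_space"
  assumes "g absolutely_integrable_on cube b m" "\<And>x. 0 \<le> g x" "cube a l \<subseteq> cube b m" "0 < l" "0 < m"
  shows "avg (cube a l) g \<le> (m / l) ^ DIM('a) * avg (cube b m) g"
proof -
  have "set_integrable lebesgue (cube a l) g"
    by (rule set_integrable_subset[OF assms(1)]) (use assms in auto)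
  then have "(LINT x:cube a l|lebesgue. g x) \<le> (LINT x:cube b m|lebesgue. g x)"
    unfolding set_lebesgue_integral_def
    using assms by (intro integral_mono) (auto simp: set_integrable_def indicator_def)
  then show ?thesis
    using assms by (simp add: avg_def power_divide divide_simps)
qed

text \<open>Replacing the mean by \<open>c\<close> costs at most the distance from \<open>c\<close>
  to the mean, which is itself bounded by the average of the deviation from \<open>c\<close>. This
  allows a convenient centre to be used in place of the true mean.\<close>

lemma mean_osc_le:
  assumes f: "f absolutely_integrable_on cube a l" and "0 < l"
  shows "mean_osc (cube a l) f \<le> 2 * avg (cube a l) (\<lambda>x. \<bar>f x - c\<bar>)"
proof -
  let ?Q = "cube a l"
  have c: "(\<lambda>x. f x - k) absolutely_integrable_on ?Q" for k
    using f by (intro set_integral_diff) auto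
  have "\<bar>avg ?Q f - c\<bar> \<le> avg ?Q (\<lambda>x. \<bar>f x - c\<bar>)"
    using abs_avg_le[OF c, of c] f \<open>0 < l\<close> by (simp add: avg_diff)
  moreover have "mean_osc ?Q f \<le> avg ?Q (\<lambda>x. \<bar>f x - c\<bar> + \<bar>avg ?Q f - c\<bar>)"
    unfolding mean_osc_def
    using c by (intro avg_mono) (auto intro!: set_integral_add set_integrable_abs)
  moreover have "\<dots> = avg ?Q (\<lambda>x. \<bar>f x - c\<bar>) + \<bar>avg ?Q f - c\<bar>"
    using c \<open>0 < l\<close> by (subst avg_add) (auto intro!: set_integrable_abs)
  ultimately show ?thesis by simp
qed


section \<open>Large and small cubes\<close>

definition locally_integrable :: "('a::euclidean_space \<Rightarrow> real) \<Rightarrow> bool" where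
  "locally_integrable f \<longleftrightarrow> (\<forall>a l. 0 < l \<longrightarrow> f absolutely_integrable_on cube a l)"

lemma locally_integrableD: "locally_integrable f \<Longrightarrow> 0 < l \<Longrightarrow> f absolutely_integrable_on cube a l"
  by (simp add: locally_integrable_def)

lemma locally_integrable_abs: "locally_integrable f \<Longrightarrow> locally_integrable (\<lambda>x. \<bar>f x\<bar>)"
  by (simp add: locally_integrable_def set_integrable_abs)

lemma locally_integrable_diff:
  "locally_integrable f \<Longrightarrow> locally_integrable g \<Longrightarrow> locally_integrable (\<lambda>x. f x - g x)"
  by (simp add: locally_integrable_def)

lemma bmo_UNIV_iff: "f \<in> bmo UNIV \<longleftrightarrow> locally_integrable f \<and> bmo_norm UNIV f < \<infinity>"
  by (simp add: bmo_def locally_integrable_def)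

text \<open>Each of the \<open>2 ^ DIM('a)\<close> subcubes contributes at most
  \<open>s ^ DIM('a) * B\<close> to the integral. For \<open>s = l / 2\<close> the factor is 1:
  bisection loses nothing.\<close>

lemma avg_subdivide_le:
  fixes a :: "'a::euclidean_space"
  assumes g: "locally_integrable g" "\<And>x. 0 \<le> g x"
    and s: "l / 2 \<le> s" "s \<le> l" "0 < l"
    and B: "\<And>b. cube b s \<subseteq> cube a l \<Longrightarrow> avg (cube b s) g \<le> B"
  shows "avg (cube a l) g \<le> (2 * s / l) ^ DIM('a) * B"
proof -
  let ?q = "\<lambda>S. cube (a + (l - s) *\<^sub>R \<Sum>S) s"
  have "0 < s" using s by simp
  have int: "g absolutely_integrable_on cube a l"
    using g s by (simp add: locally_integrableD)
  have "(LINT x:?q S|lebesgue. g x) \<le> s ^ DIM('a) * B" if "S \<in> Pow Basis" for S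
    using B[of "a + (l - s) *\<^sub>R \<Sum>S"] integral_subdivide_le(2)[OF int g(2) s, of S] that \<open>0 < s\<close>
    by (simp add: avg_def divide_simps mult.commute)
  then have "(\<Sum>S\<in>Pow Basis. LINT x:?q S|lebesgue. g x) \<le> (\<Sum>S\<in>Pow (Basis::'a set). s ^ DIM('a) * B)"
    by (rule sum_mono)
  also have "\<dots> = 2 ^ DIM('a) * (s ^ DIM('a) * B)"
    by (simp add: card_Pow)
  finally have "(LINT x:cube a l|lebesgue. g x) \<le> 2 ^ DIM('a) * (s ^ DIM('a) * B)"
    using integral_subdivide_le(1)[OF int g(2) s] by linarith
  then show ?thesis
    using s by (simp add: avg_def power_divide power_mult_distrib divide_simps mult_ac)
qed

text \<open>Lossless bisections bring the side down to at most 2; the factor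
  \<open>2 ^ DIM('a)\<close> is paid once, in the final covering by overlapping unit cubes. Only
  unit cubes inside the given cube enter, so the bound can be applied away from the origin.\<close>

lemma avg_large_cube_le:
  fixes a :: "'a::euclidean_space"
  assumes g: "locally_integrable g" "\<And>x. 0 \<le> g x" and "1 \<le> l"
    and M: "\<And>b. cube b 1 \<subseteq> cube a l \<Longrightarrow> avg (cube b 1) g \<le> M"
  shows "avg (cube a l) g \<le> 2 ^ DIM('a) * M"
proof -
  \<comment> \<open>Nonnegativity of \<open>M\<close> comes from the unit cube at the corner and is
    needed to enlarge the factor in front of \<open>M\<close>.\<close>
  have M0: "0 \<le> M" if "1 \<le> l" "\<And>b. cube b 1 \<subseteq> cube a l \<Longrightarrow> avg (cube b 1) g \<le> M" for a l
    using that(2)[OF cube_mono[OF that(1)]] avg_nonneg[of "cube a 1" g, OF g(2)] by linarith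
  have step: "avg (cube a l) g \<le> 2 ^ DIM('a) * M"
    if "1 \<le> l" "l \<le> 2" and M: "\<And>b. cube b 1 \<subseteq> cube a l \<Longrightarrow> avg (cube b 1) g \<le> M" for a l
  proof -
    have "avg (cube a l) g \<le> (2 * 1 / l) ^ DIM('a) * M"
      by (rule avg_subdivide_le[OF g]) (use that in auto)
    also have "\<dots> \<le> 2 ^ DIM('a) * M"
      using that M0[OF that(1) M] by (intro mult_right_mono power_mono) (auto simp: divide_simps)
    finally show ?thesis .
  qed
  obtain k where "l \<le> 2 ^ k"
    using real_arch_pow[of 2 l] less_imp_le by auto
  then show ?thesis
    using \<open>1 \<le> l\<close> M
  proof (induction k arbitrary: a l)
    case 0
    then show ?case using step by simp
  next
    case (Suc k)
    show ?case
    proof (cases "l \<le> 2")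
      case True
      then show ?thesis using step Suc.prems by simp
    next
      case False
      have "avg (cube a l) g \<le> (2 * (l / 2) / l) ^ DIM('a) * (2 ^ DIM('a) * M)"
      proof (rule avg_subdivide_le[OF g])
        fix b assume b: "cube b (l / 2) \<subseteq> cube a l"
        show "avg (cube b (l / 2)) g \<le> 2 ^ DIM('a) * M"
          by (rule Suc.IH) (use Suc.prems False b in auto)
      qed (use False in auto)
      then show ?thesis using False by simp
    qed
  qed
qed

text \<open>Distance from the origin is measured at the corner \<open>a\<close> so that \<open>cube a (2 * l)\<close> is as far away as
  \<open>cube a l\<close>; for sides at most 1 this differs from \<open>infdist 0 (cube a l)\<close> by at most \<open>norm One\<close>.\<close>

definition small_beyond :: "('a::euclidean_space \<Rightarrow> real) \<Rightarrow> real \<Rightarrow> real \<Rightarrow> bool" where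
  "small_beyond f \<beta> \<epsilon> \<longleftrightarrow>
     (\<forall>a l. \<beta> < norm a \<and> 0 < l \<and> l < 1 \<longrightarrow> mean_osc (cube a l) f \<le> \<epsilon>)
   \<and> (\<forall>a. \<beta> < norm a \<longrightarrow> avg (cube a 1) (\<lambda>x. \<bar>f x\<bar>) \<le> \<epsilon>)"

lemma small_beyond_nonneg:
  fixes f :: "'a::euclidean_space \<Rightarrow> real"
  assumes "small_beyond f \<beta> \<epsilon>"
  shows "0 \<le> \<epsilon>"
proof -
  \<comment> \<open>The absolute value guards against a negative \<open>\<beta>\<close>, since a
    norm must be nonnegative.\<close>
  obtain a :: 'a where "norm a = \<bar>\<beta>\<bar> + 1"
    using vector_choose_size[of "\<bar>\<beta>\<bar> + 1"] by auto
  then have "avg (cube a 1) (\<lambda>x. \<bar>f x\<bar>) \<le> \<epsilon>"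
    using assms by (auto simp: small_beyond_def)
  then show ?thesis using avg_nonneg[of "cube a 1" "\<lambda>x. \<bar>f x\<bar>"] by simp
qed

text \<open>The weighted bound is proved directly, without the logarithm. With \<open>A l\<close>
  the average over the cube of side \<open>l\<close>, doubling gives \<open>A l * l \<le> 2 ^
  DIM('a) * \<epsilon> * l + (A (2 * l) * (2 * l)) / 2\<close>. For \<open>l < 1/2\<close> each
  summand is at most half of the claimed bound, so the bound reproduces itself.\<close>

lemma avg_small_cube_le:
  fixes a :: "'a::euclidean_space"
  assumes f: "locally_integrable f" and small: "small_beyond f \<beta> \<epsilon>"
    and a: "\<beta> < norm a" and l: "0 < l" "l \<le> 1"
  shows "avg (cube a l) (\<lambda>x. \<bar>f x\<bar>) * l \<le> 2 ^ DIM('a) * \<epsilon>"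
proof -
  \<comment> \<open>The exponent \<open>k\<close> bounds the number of doublings; for
    \<open>k = 0\<close> the condition contradicts \<open>l \<le> 1\<close>.\<close>
  obtain k where "(1/2) ^ k < l"
    using real_arch_pow_inv[of l "1/2"] l by auto
  then show ?thesis using l
  proof (induction k arbitrary: l)
    case 0
    then show ?case by simp
  next
    case (Suc k)
    have int: "f absolutely_integrable_on cube a m" if "0 < m" for m
      using f that by (rule locally_integrableD)
    show ?case
    proof (cases "1/2 \<le> l")
      case True
      have "avg (cube a l) (\<lambda>x. \<bar>f x\<bar>) \<le> (1 / l) ^ DIM('a) * avg (cube a 1) (\<lambda>x. \<bar>f x\<bar>)"
        using Suc.prems by (intro avg_subcube_le set_integrable_abs int cube_mono) auto
      also have "\<dots> \<le> 2 ^ DIM('a) * \<epsilon>"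
        using True small a
        by (intro mult_mono power_mono avg_nonneg) (auto simp: small_beyond_def divide_simps)
      finally have le: "avg (cube a l) (\<lambda>x. \<bar>f x\<bar>) \<le> 2 ^ DIM('a) * \<epsilon>" .
      have "avg (cube a l) (\<lambda>x. \<bar>f x\<bar>) * l \<le> avg (cube a l) (\<lambda>x. \<bar>f x\<bar>) * 1"
        using Suc.prems by (intro mult_left_mono avg_nonneg) auto
      with le show ?thesis by simp
    next
      case False
      \<comment> \<open>Doubling keeps the corner \<open>a\<close>, hence the condition
        \<open>\<beta> < norm a\<close>, and the side stays below 1, so the oscillation bound
        applies to the larger cube.\<close>
      let ?Q = "cube a l" and ?R = "cube a (2 * l)"
      let ?c = "avg ?R f"
      have l: "0 < l" "0 < 2 * l" "2 * l < 1" using Suc.prems False by auto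
      have intd: "(\<lambda>x. \<bar>f x - ?c\<bar>) absolutely_integrable_on cube a m" if "0 < m" for m
        using int[OF that] by (intro set_integrable_abs set_integral_diff) auto
      have "avg ?Q (\<lambda>x. \<bar>f x\<bar>) \<le> avg ?Q (\<lambda>x. \<bar>f x - ?c\<bar> + \<bar>?c\<bar>)"
        using intd int l by (intro avg_mono set_integrable_abs set_integral_add) auto
      also have "\<dots> = avg ?Q (\<lambda>x. \<bar>f x - ?c\<bar>) + \<bar>?c\<bar>"
        using intd l by (subst avg_add) auto
      also have "avg ?Q (\<lambda>x. \<bar>f x - ?c\<bar>) \<le> (2 * l / l) ^ DIM('a) * avg ?R (\<lambda>x. \<bar>f x - ?c\<bar>)"
        using l by (intro avg_subcube_le intd cube_mono) auto
      also have "\<dots> \<le> 2 ^ DIM('a) * \<epsilon>"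
        using l small a by (auto simp: small_beyond_def mean_osc_def)
      also have "\<bar>?c\<bar> \<le> avg ?R (\<lambda>x. \<bar>f x\<bar>)"
        using l by (intro abs_avg_le int)
      finally have "avg ?Q (\<lambda>x. \<bar>f x\<bar>) * l \<le> (2 ^ DIM('a) * \<epsilon> + avg ?R (\<lambda>x. \<bar>f x\<bar>)) * l"
        using l by (simp add: mult_right_mono)
      moreover have "avg ?R (\<lambda>x. \<bar>f x\<bar>) * (2 * l) \<le> 2 ^ DIM('a) * \<epsilon>"
        using Suc.prems l by (intro Suc.IH) auto
      moreover have "(2 ^ DIM('a) * \<epsilon>) * (2 * l) \<le> (2 ^ DIM('a) * \<epsilon>) * 1"
        using l small_beyond_nonneg[OF small] by (intro mult_left_mono) auto
      ultimately show ?thesis by (simp add: algebra_simps)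
    qed
  qed
qed


section \<open>Cutting off\<close>

lemma bmo_norm_le:
  assumes "\<And>a l. 0 < l \<Longrightarrow> l < 1 \<Longrightarrow> cube a l \<subseteq> U \<Longrightarrow> mean_osc (cube a l) f \<le> A"
    and "\<And>a l. 1 \<le> l \<Longrightarrow> cube a l \<subseteq> U \<Longrightarrow> avg (cube a l) (\<lambda>x. \<bar>f x\<bar>) \<le> B"
    and "0 \<le> A" "0 \<le> B"
  shows "bmo_norm U f \<le> ennreal (A + B)"
  unfolding bmo_norm_def ennreal_plus[OF assms(3,4)]
  by (intro add_mono SUP_least) (auto intro!: ennreal_leI assms(1,2))

lemma mean_osc_le_bmo_norm:
  "0 < l \<Longrightarrow> l < 1 \<Longrightarrow> cube a l \<subseteq> U \<Longrightarrow> ennreal (mean_osc (cube a l) f) \<le> bmo_norm U f"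
  unfolding bmo_norm_def by (rule add_increasing2) (auto intro!: SUP_upper2[of "(a, l)"])

lemma avg_le_bmo_norm:
  "1 \<le> l \<Longrightarrow> cube a l \<subseteq> U \<Longrightarrow> ennreal (avg (cube a l) (\<lambda>x. \<bar>f x\<bar>)) \<le> bmo_norm U f"
  unfolding bmo_norm_def by (rule add_increasing) (auto intro!: SUP_upper2[of "(a, l)"])

lemma mean_osc_diff_le:
  assumes f: "f absolutely_integrable_on cube a l" and g: "g absolutely_integrable_on cube a l"
    and "0 < l"
  shows "mean_osc (cube a l) (\<lambda>x. f x - g x) \<le> mean_osc (cube a l) f + mean_osc (cube a l) g"
proof -
  let ?Q = "cube a l"
  have int: "(\<lambda>x. \<bar>u x - k\<bar>) absolutely_integrable_on ?Q"
    if "u absolutely_integrable_on ?Q" for u :: "'a \<Rightarrow> real" and k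
    using that by (intro set_integrable_abs set_integral_diff) auto
  have "mean_osc ?Q (\<lambda>x. f x - g x) \<le> avg ?Q (\<lambda>x. \<bar>f x - avg ?Q f\<bar> + \<bar>g x - avg ?Q g\<bar>)"
    unfolding mean_osc_def avg_diff[OF f g]
    using f g by (intro avg_mono set_integral_add int) auto
  then show ?thesis
    by (simp add: mean_osc_def avg_add int f g)
qed

lemma bmo_norm_diff_finite:
  assumes f: "locally_integrable f" "bmo_norm U f < \<infinity>"
    and g: "locally_integrable g" "bmo_norm U g < \<infinity>"
  shows "bmo_norm U (\<lambda>x. f x - g x) < \<infinity>"
proof -
  define A where "A = enn2real (bmo_norm U f)"
  define B where "B = enn2real (bmo_norm U g)"
  have AB: "bmo_norm U f = ennreal A" "bmo_norm U g = ennreal B" "0 \<le> A" "0 \<le> B"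
    using f g by (auto simp: A_def B_def)
  \<comment> \<open>One \<open>A + B\<close> for each of the two suprema; the estimate is crude
    because only finiteness matters.\<close>
  have "bmo_norm U (\<lambda>x. f x - g x) \<le> ennreal ((A + B) + (A + B))"
  proof (rule bmo_norm_le)
    fix a l assume l: "0 < l" "l < 1" and U: "cube a l \<subseteq> U"
    have "mean_osc (cube a l) (\<lambda>x. f x - g x) \<le> mean_osc (cube a l) f + mean_osc (cube a l) g"
      using f g l by (intro mean_osc_diff_le locally_integrableD)
    also have "\<dots> \<le> A + B"
      using mean_osc_le_bmo_norm[OF l U, of f] mean_osc_le_bmo_norm[OF l U, of g] AB
      by (intro add_mono) auto
    finally show "mean_osc (cube a l) (\<lambda>x. f x - g x) \<le> A + B" .
  next
    fix a l assume l: "1 \<le> l" and U: "cube a l \<subseteq> U"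
    have int: "f absolutely_integrable_on cube a l" "g absolutely_integrable_on cube a l"
      using f g l by (auto intro: locally_integrableD)
    have "avg (cube a l) (\<lambda>x. \<bar>f x - g x\<bar>) \<le> avg (cube a l) (\<lambda>x. \<bar>f x\<bar> + \<bar>g x\<bar>)"
      using int by (intro avg_mono set_integrable_abs set_integral_add set_integral_diff) auto
    also have "\<dots> = avg (cube a l) (\<lambda>x. \<bar>f x\<bar>) + avg (cube a l) (\<lambda>x. \<bar>g x\<bar>)"
      using int by (intro avg_add set_integrable_abs)
    also have "\<dots> \<le> A + B"
      using avg_le_bmo_norm[OF l U, of f] avg_le_bmo_norm[OF l U, of g] AB
      by (intro add_mono) auto
    finally show "avg (cube a l) (\<lambda>x. \<bar>f x - g x\<bar>) \<le> A + B" .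
  qed (use AB in auto)
  also have "\<dots> < \<infinity>"
    by simp
  finally show ?thesis .
qed

section \<open>Multiplication by a Lipschitz cutoff\<close>

text \<open>This function keeps the part near infinity: \<open>cutoff R x * f x\<close> is the tail
  to be made small in norm, and subtracting it from \<open>f\<close> leaves the compactly supported
  approximant. Its Lipschitz constant is 1 for every \<open>R\<close>.\<close>

definition cutoff :: "real \<Rightarrow> 'a::euclidean_space \<Rightarrow> real" where
  "cutoff R x = min 1 (max 0 (norm x - R))"

lemma cutoff_nonneg: "0 \<le> cutoff R x" and cutoff_le_1: "cutoff R x \<le> 1"
  by (auto simp: cutoff_def)

lemma abs_cutoff [simp]: "\<bar>cutoff R x\<bar> = cutoff R x"
  by (simp add: cutoff_nonneg)

lemma abs_cutoff_diff_le: "\<bar>cutoff R x - cutoff R y\<bar> \<le> norm (x - y)"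
  using norm_triangle_ineq3[of x y] by (auto simp: cutoff_def min_def max_def)

lemma cutoff_eq_0: "norm x \<le> R \<Longrightarrow> cutoff R x = 0"
  by (simp add: cutoff_def)

lemma cutoff_eq_1: "R + 1 \<le> norm x \<Longrightarrow> cutoff R x = 1"
  by (simp add: cutoff_def)

lemma locally_integrable_cutoff:
  assumes "locally_integrable f"
  shows "locally_integrable (\<lambda>x. cutoff R x * f x)"
  unfolding locally_integrable_def
proof (intro allI impI)
  fix a :: 'a and l :: real assume "0 < l"
  have "continuous_on (cube a l) (cutoff R)"
    unfolding cutoff_def by (intro continuous_intros)
  then have "cutoff R \<in> borel_measurable (lebesgue_on (cube a l))"
    by (simp add: continuous_imp_measurable_on_sets_lebesgue)
  moreover have "bounded (cutoff R ` cube a l)"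
    by (auto simp: bounded_iff cutoff_le_1 intro!: exI[of _ 1])
  ultimately show "(\<lambda>x. cutoff R x * f x) absolutely_integrable_on cube a l"
    using absolutely_integrable_bounded_measurable_product[OF bilinear_times _ sets_cube]
      locally_integrableD[OF assms \<open>0 < l\<close>] by blast
qed

text \<open>The first \<open>\<epsilon>\<close> is the oscillation of \<open>f\<close>; the other
  term is the variation of the cutoff, at most \<open>l * norm One\<close> on the cube, times the
  mean of \<open>f\<close>, which \<open>avg_small_cube_le\<close> controls.\<close>

lemma mean_osc_cutoff_le:
  fixes f :: "'a::euclidean_space \<Rightarrow> real"
  assumes f: "locally_integrable f" and small: "small_beyond f \<beta> \<epsilon>"
    and a: "\<beta> < norm a" and l: "0 < l" "l < 1"
  shows "mean_osc (cube a l) (\<lambda>x. cutoff R x * f x) \<le> 2 * (\<epsilon> + norm (One :: 'a) * (2 ^ DIM('a) * \<epsilon>))"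
proof -
  let ?Q = "cube a l" and ?K = "norm (One :: 'a)" and ?\<eta> = "cutoff R"
  let ?m = "avg ?Q f"
  have int: "f absolutely_integrable_on ?Q" "(\<lambda>x. ?\<eta> x * f x) absolutely_integrable_on ?Q"
    using f l by (auto intro!: locally_integrableD locally_integrable_cutoff)
  have intd: "(\<lambda>x. \<bar>u x - c\<bar>) absolutely_integrable_on ?Q"
    if "u absolutely_integrable_on ?Q" for u :: "'a \<Rightarrow> real" and c
    using that by (intro set_integrable_abs set_integral_diff) auto
  \<comment> \<open>The factor 2 is the price for centring at the cutoff value at the corner times
    the mean of \<open>f\<close>.\<close>
  have "mean_osc ?Q (\<lambda>x. ?\<eta> x * f x) \<le> 2 * avg ?Q (\<lambda>x. \<bar>?\<eta> x * f x - ?\<eta> a * ?m\<bar>)"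
    by (rule mean_osc_le[OF int(2) l(1)])
  also have "avg ?Q (\<lambda>x. \<bar>?\<eta> x * f x - ?\<eta> a * ?m\<bar>) \<le> avg ?Q (\<lambda>x. \<bar>f x - ?m\<bar> + \<bar>?m\<bar> * (l * ?K))"
  proof (intro avg_mono set_integral_add intd int)
    fix x assume x: "x \<in> ?Q"
    have "\<bar>?\<eta> x * f x - ?\<eta> a * ?m\<bar> = \<bar>?\<eta> x * (f x - ?m) + ?m * (?\<eta> x - ?\<eta> a)\<bar>"
      by (simp add: algebra_simps)
    also have "\<dots> \<le> \<bar>?\<eta> x * (f x - ?m)\<bar> + \<bar>?m * (?\<eta> x - ?\<eta> a)\<bar>"
      by (rule abs_triangle_ineq)
    also have "\<dots> = ?\<eta> x * \<bar>f x - ?m\<bar> + \<bar>?m\<bar> * \<bar>?\<eta> x - ?\<eta> a\<bar>"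
      by (simp add: abs_mult cutoff_nonneg)
    also have "\<dots> \<le> \<bar>f x - ?m\<bar> + \<bar>?m\<bar> * (l * ?K)"
      using norm_diff_corner_le[OF x] l abs_cutoff_diff_le[of R x a]
      by (intro add_mono mult_left_mono mult_left_le_one_le cutoff_nonneg cutoff_le_1) auto
    finally show "\<bar>?\<eta> x * f x - ?\<eta> a * ?m\<bar> \<le> \<bar>f x - ?m\<bar> + \<bar>?m\<bar> * (l * ?K)" .
  qed auto
  also have "\<dots> = mean_osc ?Q f + \<bar>?m\<bar> * (l * ?K)"
    using l by (subst avg_add) (auto intro: intd int simp: mean_osc_def)
  also have "\<dots> \<le> \<epsilon> + ?K * (2 ^ DIM('a) * \<epsilon>)"
  proof (rule add_mono)
    show "mean_osc ?Q f \<le> \<epsilon>" using small a l by (auto simp: small_beyond_def)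
    have "\<bar>?m\<bar> * l \<le> avg ?Q (\<lambda>x. \<bar>f x\<bar>) * l"
      using l by (intro mult_right_mono abs_avg_le int) auto
    also have "\<dots> \<le> 2 ^ DIM('a) * \<epsilon>"
      using l by (intro avg_small_cube_le[OF f small a]) auto
    finally show "\<bar>?m\<bar> * (l * ?K) \<le> ?K * (2 ^ DIM('a) * \<epsilon>)"
      by (metis mult.commute mult.left_commute mult_left_mono norm_ge_zero)
  qed
  finally show ?thesis by simp
qed

text \<open>A cube of side at most 1 with corner within \<open>\<beta>\<close> of the origin lies in
  the ball of radius \<open>\<beta> + norm One\<close>, where the cutoff vanishes by the choice of
  \<open>R\<close>. The other small cubes fall under \<open>small_beyond\<close>, and large cubes
  reduce to unit ones.\<close>

lemma bmo_norm_cutoff_le: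
  fixes f :: "'a::euclidean_space \<Rightarrow> real"
  assumes f: "locally_integrable f" and small: "small_beyond f \<beta> \<epsilon>"
    and R: "\<beta> + norm (One :: 'a) \<le> R"
  shows "bmo_norm UNIV (\<lambda>x. cutoff R x * f x)
       \<le> ennreal (2 * (\<epsilon> + norm (One :: 'a) * (2 ^ DIM('a) * \<epsilon>)) + 2 ^ DIM('a) * \<epsilon>)"
proof -
  let ?h = "\<lambda>x. cutoff R x * f x"
  have \<epsilon>: "0 \<le> \<epsilon>" by (rule small_beyond_nonneg[OF small])
  have h: "locally_integrable ?h" by (rule locally_integrable_cutoff[OF f])
  have zero: "?h x = 0" if "norm a \<le> \<beta>" "0 < l" "l \<le> 1" "x \<in> cube a l" for a x :: 'a and l
  proof -
    have "norm x \<le> norm a + norm (x - a)"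
      using norm_triangle_sub by blast
    also have "norm (x - a) \<le> l * norm (One :: 'a)"
      using that by (intro norm_diff_corner_le) auto
    also have "l * norm (One :: 'a) \<le> 1 * norm (One :: 'a)"
      using that by (intro mult_right_mono) auto
    finally show ?thesis using that R by (simp add: cutoff_eq_0)
  qed
  have avg0: "avg Q u = 0" if "\<And>x. x \<in> Q \<Longrightarrow> u x = 0" for Q and u :: "'a \<Rightarrow> real"
  proof -
    have "indicat_real Q x *\<^sub>R u x = 0" for x
      using that by (simp add: indicator_def)
    then show ?thesis by (simp only: avg_def set_lebesgue_integral_def) simp
  qed
  show ?thesis
  proof (rule bmo_norm_le)
    fix a :: 'a and l :: real assume l: "0 < l" "l < 1"
    show "mean_osc (cube a l) ?h \<le> 2 * (\<epsilon> + norm (One :: 'a) * (2 ^ DIM('a) * \<epsilon>))"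
    proof (cases "\<beta> < norm a")
      case True
      then show ?thesis using l by (intro mean_osc_cutoff_le[OF f small])
    next
      case False
      then have "mean_osc (cube a l) ?h = 0"
        using zero[of a l] l by (simp add: mean_osc_def avg0)
      then show ?thesis using \<epsilon> by simp
    qed
  next
    fix a :: 'a and l :: real assume l: "1 \<le> l"
    show "avg (cube a l) (\<lambda>x. \<bar>?h x\<bar>) \<le> 2 ^ DIM('a) * \<epsilon>"
    proof (rule avg_large_cube_le[OF locally_integrable_abs[OF h] _ l])
      fix b :: 'a
      show "avg (cube b 1) (\<lambda>x. \<bar>?h x\<bar>) \<le> \<epsilon>"
      proof (cases "\<beta> < norm b")
        case True
        have "avg (cube b 1) (\<lambda>x. \<bar>?h x\<bar>) \<le> avg (cube b 1) (\<lambda>x. \<bar>f x\<bar>)"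
          using f h by (intro avg_mono locally_integrableD locally_integrable_abs)
            (auto simp: abs_mult intro!: mult_left_le_one_le cutoff_nonneg cutoff_le_1)
        also have "\<dots> \<le> \<epsilon>" using small True by (simp add: small_beyond_def)
        finally show ?thesis .
      next
        case False
        then show ?thesis using zero[of b 1] \<epsilon> by (simp add: avg0)
      qed
    qed simp
  qed (use \<epsilon> in auto)
qed


section \<open>Vanishing at infinity\<close>

text \<open>The open sets in the definition may be uncountably many; the Lindelof property leaves
  countably many exceptional null sets.\<close>

lemma AE_outside_ess_support:
  "AE x in lebesgue. x \<notin> ess_support f \<longrightarrow> f x = 0"
proof -
  define \<V> where "\<V> = {V. open V \<and> (AE x\<in>V in lebesgue. f x = 0)}"
  obtain \<W> where \<W>: "\<W> \<subseteq> \<V>" "countable \<W>" "\<Union>\<W> = \<Union>\<V>"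
    using Lindelof[of \<V>] unfolding \<V>_def by blast
  have "AE x in lebesgue. \<forall>V\<in>\<W>. x \<in> V \<longrightarrow> f x = 0"
    using \<W> by (subst AE_ball_countable) (auto simp: \<V>_def)
  then show ?thesis
  proof eventually_elim
    case (elim x)
    then show ?case using \<W>(3) by (auto simp: ess_support_def \<V>_def)
  qed
qed

lemma compact_ess_support:
  assumes "\<And>x. r < norm x \<Longrightarrow> f x = 0"
  shows "compact (ess_support f)"
proof -
  have "closed (ess_support f)"
    unfolding ess_support_def by (intro closed_Compl open_Union) auto
  moreover have "ess_support f \<subseteq> cball 0 r"
  proof -
    have "open (- cball 0 r)" "AE x\<in>- cball 0 r in lebesgue. f x = 0"
      using assms by auto
    then show ?thesis unfolding ess_support_def by blast
  qed
  ultimately show ?thesis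
    using bounded_subset[OF bounded_cball] by (simp add: compact_eq_bounded_closed)
qed

lemma mean_osc_cong_AE:
  assumes "f absolutely_integrable_on Q" "g absolutely_integrable_on Q"
    and eq: "AE x\<in>Q in lebesgue. f x = g x"
    and "Q \<in> lmeasurable"
  shows "mean_osc Q f = mean_osc Q g"
proof -
  have "avg Q f = avg Q g" by (rule avg_cong_AE[OF assms(1,2) eq])
  moreover have "AE x\<in>Q in lebesgue. \<bar>f x - avg Q g\<bar> = \<bar>g x - avg Q g\<bar>"
    using eq by (auto elim: eventually_mono)
  ultimately show ?thesis
    unfolding mean_osc_def using assms
    by (auto intro!: avg_cong_AE set_integrable_abs set_integral_diff)
qed

text \<open>Combines monotonicity in the domain with insensitivity to null sets, as an essential
  support gives equality only almost everywhere.\<close>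

lemma bmo_norm_cong_AE_le:
  assumes f: "locally_integrable f" and g: "locally_integrable g"
    and eq: "AE x\<in>U in lebesgue. f x = g x" and "U \<subseteq> V"
  shows "bmo_norm U f \<le> bmo_norm V g"
proof -
  have Q: "AE x\<in>Q in lebesgue. f x = g x" if "Q \<subseteq> U" for Q
    using eq that by (auto elim!: eventually_mono)
  have "mean_osc (cube a l) f = mean_osc (cube a l) g" if "0 < l" "cube a l \<subseteq> U" for a l
    using that f g by (intro mean_osc_cong_AE Q locally_integrableD) auto
  moreover have "avg (cube a l) (\<lambda>x. \<bar>f x\<bar>) = avg (cube a l) (\<lambda>x. \<bar>g x\<bar>)"
    if "1 \<le> l" "cube a l \<subseteq> U" for a l
    using that f g Q[OF that(2)]
    by (intro avg_cong_AE locally_integrableD locally_integrable_abs) (auto elim: eventually_mono)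
  ultimately show ?thesis
    unfolding bmo_norm_def using \<open>U \<subseteq> V\<close>
    by (intro add_mono SUP_subset_mono) auto
qed

section \<open>Passing between limits and bounds\<close>

lemma tendsto_ennreal_0I:
  fixes F :: "real \<Rightarrow> ennreal"
  assumes "\<And>\<epsilon>. 0 < \<epsilon> \<Longrightarrow> \<exists>\<beta>. \<forall>R\<ge>\<beta>. F R \<le> ennreal (C * \<epsilon>)" "0 < C"
  shows "(F \<longlongrightarrow> 0) at_top"
proof (rule order_tendstoI)
  fix e :: ennreal assume "0 < e"
  \<comment> \<open>A finite positive level below \<open>e\<close> is chosen, since \<open>e\<close>
    itself may be infinite.\<close>
  then obtain d where d: "0 < d" "ennreal d < e"
  proof (cases e)
    case (real r)
    with \<open>0 < e\<close> show ?thesis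
      by (intro that[of "r / 2"]) (auto simp: ennreal_less_iff)
  qed (auto intro: that[of 1])
  obtain \<beta> where "\<forall>R\<ge>\<beta>. F R \<le> ennreal (C * (d / C))"
    using assms(1)[of "d / C"] d \<open>0 < C\<close> by auto
  then have "\<forall>R\<ge>\<beta>. F R < e"
    using d \<open>0 < C\<close> by (auto intro: le_less_trans)
  then show "eventually (\<lambda>R. F R < e) at_top"
    by (auto simp: eventually_at_top_linorder)
qed simp

lemma small_beyondI:
  fixes f :: "'a::euclidean_space \<Rightarrow> real"
  assumes "gamma f \<beta> \<le> ennreal \<epsilon>" "0 \<le> \<epsilon>"
  shows "small_beyond f (\<beta> + norm (One :: 'a)) \<epsilon>"
proof -
  \<comment> \<open>The shift by \<open>norm One\<close> pays for passing from the corner to all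
    points of a cube of side at most 1.\<close>
  have far: "\<beta> < infdist 0 (cube a l)" if "\<beta> + norm (One :: 'a) < norm a" "0 < l" "l \<le> 1" for a :: 'a and l
    unfolding less_infdist_cube[OF less_imp_le[OF that(2)]]
  proof
    fix x assume "x \<in> cube a l"
    then have "norm (x - a) \<le> l * norm (One :: 'a)"
      using that by (intro norm_diff_corner_le) auto
    also have "\<dots> \<le> 1 * norm (One :: 'a)"
      using that by (intro mult_right_mono) auto
    finally show "\<beta> < norm x"
      using that norm_triangle_sub[of a x] by (simp add: norm_minus_commute)
  qed
  have "ennreal (mean_osc (cube a l) f) \<le> gamma f \<beta>" if "\<beta> + norm (One :: 'a) < norm a" "0 < l" "l < 1" for a l
    unfolding gamma_def using far[of a l] that
    by (intro add_increasing2) (auto intro!: SUP_upper2[of "(a, l)"])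
  moreover have "ennreal (avg (cube a 1) (\<lambda>x. \<bar>f x\<bar>)) \<le> gamma f \<beta>" if "\<beta> + norm (One :: 'a) < norm a" for a
    unfolding gamma_def using far[of a 1] that
    by (intro add_increasing) (auto intro!: SUP_upper2[of "(a, 1)"])
  moreover have "r \<le> \<epsilon>" if "ennreal r \<le> gamma f \<beta>" for r
    using order_trans[OF that assms(1)] assms(2) by simp
  ultimately show ?thesis
    unfolding small_beyond_def by blast
qed

lemma gamma_tendsto_0D:
  assumes "(gamma f \<longlongrightarrow> 0) at_top" "0 < \<epsilon>"
  shows "\<exists>\<beta>. small_beyond f \<beta> \<epsilon>"
proof -
  have "eventually (\<lambda>\<beta>. gamma f \<beta> < ennreal \<epsilon>) at_top"
    using order_tendstoD(2)[OF assms(1), of "ennreal \<epsilon>"] assms(2) by simp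
  then obtain \<beta> where "gamma f \<beta> < ennreal \<epsilon>"
    using eventually_happens'[OF trivial_limit_at_top_linorder] by blast
  then show ?thesis
    using small_beyondI[OF less_imp_le less_imp_le[OF assms(2)]] by blast
qed

lemma tendsto_0_le:
  fixes F G :: "real \<Rightarrow> ennreal"
  assumes "(G \<longlongrightarrow> 0) at_top" "\<And>R. F R \<le> G R"
  shows "(F \<longlongrightarrow> 0) at_top"
  by (rule tendsto_sandwich[OF _ _ tendsto_const assms(1)]) (simp_all add: assms(2))

text \<open>Gives (ii) to (iii): a cube at distance more than \<open>R\<close> avoids the closed
  ball, and side 1 is among the sides at least 1.\<close>

lemma gamma_le_bmo_norm:
  "gamma f R \<le> bmo_norm (UNIV - cball 0 R) f"
  unfolding gamma_def bmo_norm_def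
  by (intro add_mono SUP_subset_mono) (fastforce simp: less_infdist_cube)+

text \<open>Gives (iv) to (iii): at side 1 the weight is 1.\<close>

lemma gamma_le_gamma_weighted: "gamma f \<beta> \<le> gamma_weighted f \<beta>"
  unfolding gamma_def gamma_weighted_def
  by (intro add_mono order_refl SUP_subset_mono) auto

section \<open>The implications between the four conditions\<close>

lemma bmo_norm_outside_tendsto_0:
  fixes f :: "'a::euclidean_space \<Rightarrow> real"
  assumes f: "locally_integrable f" and "(gamma f \<longlongrightarrow> 0) at_top"
  shows "((\<lambda>R. bmo_norm (UNIV - cball 0 R) f) \<longlongrightarrow> 0) at_top"
proof (rule tendsto_ennreal_0I[where C = "1 + 2 ^ DIM('a)"])
  fix \<epsilon> :: real assume "0 < \<epsilon>"
  then obtain \<beta> where small: "small_beyond f \<beta> \<epsilon>"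
    using gamma_tendsto_0D[OF assms(2)] by blast
  have corner: "\<beta> < norm a" if "cube a l \<subseteq> UNIV - cball 0 R" "0 < l" "\<beta> \<le> R" for a :: 'a and l R
    using that corner_in_cube[of l a] by auto
  have "bmo_norm (UNIV - cball 0 R) f \<le> ennreal (\<epsilon> + 2 ^ DIM('a) * \<epsilon>)" if "\<beta> \<le> R" for R
  proof (rule bmo_norm_le)
    fix a :: 'a and l assume "0 < l" "l < 1" "cube a l \<subseteq> UNIV - cball 0 R"
    then show "mean_osc (cube a l) f \<le> \<epsilon>"
      using small corner that by (auto simp: small_beyond_def)
  next
    fix a :: 'a and l assume l: "1 \<le> l" and U: "cube a l \<subseteq> UNIV - cball 0 R"
    show "avg (cube a l) (\<lambda>x. \<bar>f x\<bar>) \<le> 2 ^ DIM('a) * \<epsilon>"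
    proof (rule avg_large_cube_le[OF locally_integrable_abs[OF f] _ l])
      fix b :: 'a assume "cube b 1 \<subseteq> cube a l"
      \<comment> \<open>Unit subcubes of a cube outside the ball are also outside it, so their
        corners are beyond \<open>\<beta>\<close>.\<close>
      then have "\<beta> < norm b" using corner[of b 1 R] U that by auto
      then show "avg (cube b 1) (\<lambda>x. \<bar>f x\<bar>) \<le> \<epsilon>"
        using small by (simp add: small_beyond_def)
    qed simp
  qed (use \<open>0 < \<epsilon>\<close> in auto)
  then show "\<exists>\<beta>. \<forall>R\<ge>\<beta>. bmo_norm (UNIV - cball 0 R) f \<le> ennreal ((1 + 2 ^ DIM('a)) * \<epsilon>)"
    by (auto simp: distrib_right)
qed (simp add: add_pos_pos)

lemma gamma_weighted_tendsto_0:
  fixes f :: "'a::euclidean_space \<Rightarrow> real"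
  assumes f: "locally_integrable f" and "(gamma f \<longlongrightarrow> 0) at_top"
  shows "(gamma_weighted f \<longlongrightarrow> 0) at_top"
proof (rule tendsto_ennreal_0I[where C = "1 + 2 ^ DIM('a)"])
  fix \<epsilon> :: real assume "0 < \<epsilon>"
  then obtain \<beta> where small: "small_beyond f \<beta> \<epsilon>"
    using gamma_tendsto_0D[OF assms(2)] by blast
  have corner: "\<beta> < norm a" if "R < infdist 0 (cube a l)" "0 < l" "\<beta> \<le> R" for a :: 'a and l R
    using that corner_in_cube[of l a] less_infdist_cube[of l R a] by auto
  have "gamma_weighted f R \<le> ennreal \<epsilon> + ennreal (2 ^ DIM('a) * \<epsilon>)" if "\<beta> \<le> R" for R
    unfolding gamma_weighted_def
  proof (intro add_mono SUP_least; clarify; intro ennreal_leI)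
    fix a :: 'a and l assume "0 < l" "l < 1" "R < infdist 0 (cube a l)"
    then show "mean_osc (cube a l) f \<le> \<epsilon>"
      using small corner that by (auto simp: small_beyond_def)
  next
    fix a :: 'a and l assume "0 < l" "l \<le> 1" "R < infdist 0 (cube a l)"
    then show "avg (cube a l) (\<lambda>x. \<bar>f x\<bar>) * l \<le> 2 ^ DIM('a) * \<epsilon>"
      using corner that by (intro avg_small_cube_le[OF f small]) auto
  qed
  then show "\<exists>\<beta>. \<forall>R\<ge>\<beta>. gamma_weighted f R \<le> ennreal ((1 + 2 ^ DIM('a)) * \<epsilon>)"
    using \<open>0 < \<epsilon>\<close> by (auto simp: distrib_right ennreal_plus)
qed (simp add: add_pos_pos)

lemma bmo_closure_bmo_cI:
  fixes f :: "'a::euclidean_space \<Rightarrow> real"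
  assumes f: "f \<in> bmo UNIV" and "(gamma f \<longlongrightarrow> 0) at_top"
  shows "f \<in> bmo_closure bmo_c"
  unfolding bmo_closure_def
proof (intro CollectI conjI allI impI f)
  fix \<epsilon> :: real assume "0 < \<epsilon>"
  \<comment> \<open>\<open>C\<close> is the coefficient of \<open>\<delta>\<close> in the bound for
    the tail; \<open>\<delta>\<close> is then set to make that bound \<open>\<epsilon> / 2\<close>,
    strictly below \<open>\<epsilon>\<close>.\<close>
  define C where "C = 2 * (1 + norm (One :: 'a) * 2 ^ DIM('a)) + 2 ^ DIM('a)"
  have "0 < C" by (simp add: C_def add_nonneg_pos)
  define \<delta> where "\<delta> = \<epsilon> / (2 * C)"
  have "0 < \<delta>" using \<open>0 < \<epsilon>\<close> \<open>0 < C\<close> by (simp add: \<delta>_def)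
  then obtain \<beta> where small: "small_beyond f \<beta> \<delta>"
    using gamma_tendsto_0D[OF assms(2)] by blast
  have loc: "locally_integrable f" and fin: "bmo_norm UNIV f < \<infinity>"
    using f by (auto simp: bmo_UNIV_iff)
  define R where "R = \<beta> + norm (One :: 'a)"
  define h where "h = (\<lambda>x. cutoff R x * f x)"
  define g where "g = (\<lambda>x. f x - h x)"
  have h: "locally_integrable h"
    unfolding h_def by (rule locally_integrable_cutoff[OF loc])
  have "bmo_norm UNIV h \<le> ennreal (2 * (\<delta> + norm (One :: 'a) * (2 ^ DIM('a) * \<delta>)) + 2 ^ DIM('a) * \<delta>)"
    unfolding h_def by (rule bmo_norm_cutoff_le[OF loc small]) (simp add: R_def)
  also have "\<dots> = ennreal (C * \<delta>)"
    by (simp add: C_def algebra_simps)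
  also have "C * \<delta> = \<epsilon> / 2"
    using \<open>0 < C\<close> by (simp add: \<delta>_def)
  also have "ennreal (\<epsilon> / 2) < ennreal \<epsilon>"
    using \<open>0 < \<epsilon>\<close> by (simp add: ennreal_less_iff)
  finally have h_small: "bmo_norm UNIV h < ennreal \<epsilon>" .
  then have "bmo_norm UNIV h < \<infinity>"
    by (rule less_trans) simp
  then have "g \<in> bmo UNIV"
    using loc fin h unfolding bmo_UNIV_iff g_def
    by (auto intro!: locally_integrable_diff bmo_norm_diff_finite simp del: infinity_ennreal_def)
  moreover have "compact (ess_support g)"
    by (rule compact_ess_support[of "R + 1"]) (simp add: g_def h_def cutoff_eq_1)
  ultimately have "g \<in> bmo_c" by (simp add: bmo_c_def)
  moreover have "(\<lambda>x. f x - g x) = h" by (simp add: g_def)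
  ultimately show "\<exists>g\<in>bmo_c. bmo_norm UNIV (\<lambda>x. f x - g x) < ennreal \<epsilon>"
    using h_small by (intro bexI[of _ g]) simp_all
qed

text \<open>This is (i) to (ii): outside a ball containing the essential support of the approximant
  \<open>g\<close>, the functions \<open>f\<close> and \<open>f - g\<close> agree almost everywhere,
  and the latter is small in norm on the whole space.\<close>

lemma bmo_closure_bmo_c_tendsto_0:
  fixes f :: "'a::euclidean_space \<Rightarrow> real"
  assumes "f \<in> bmo_closure bmo_c"
  shows "((\<lambda>R. bmo_norm (UNIV - cball 0 R) f) \<longlongrightarrow> 0) at_top"
proof (rule tendsto_ennreal_0I[where C = 1])
  fix \<epsilon> :: real assume "0 < \<epsilon>"
  then obtain g where g: "g \<in> bmo UNIV" "compact (ess_support g)"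
    and fg: "bmo_norm UNIV (\<lambda>x. f x - g x) < ennreal \<epsilon>"
    using assms by (auto simp: bmo_closure_def bmo_c_def)
  obtain \<beta> where \<beta>: "ess_support g \<subseteq> cball 0 \<beta>"
    using bounded_subset_ballD[OF compact_imp_bounded[OF g(2)], of 0] ball_subset_cball by blast
  have loc: "locally_integrable f" "locally_integrable g"
    using assms g by (auto simp: bmo_closure_def bmo_UNIV_iff)
  have "bmo_norm (UNIV - cball 0 R) f \<le> ennreal (1 * \<epsilon>)" if "\<beta> \<le> R" for R
  proof -
    have "AE x\<in>UNIV - cball 0 R in lebesgue. f x = f x - g x"
      using AE_outside_ess_support[of g] by eventually_elim (use \<beta> that in auto)
    then have "bmo_norm (UNIV - cball 0 R) f \<le> bmo_norm UNIV (\<lambda>x. f x - g x)"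
      using loc by (intro bmo_norm_cong_AE_le locally_integrable_diff) auto
    with fg show ?thesis by simp
  qed
  then show "\<exists>\<beta>. \<forall>R\<ge>\<beta>. bmo_norm (UNIV - cball 0 R) f \<le> ennreal (1 * \<epsilon>)"
    by blast
qed simp

theorem proposition2:
  fixes f :: "real ^ 'n \<Rightarrow> real"
  assumes "f \<in> bmo UNIV"
  shows "(f \<in> bmo_closure bmo_c \<longleftrightarrow> ((\<lambda>R. bmo_norm (UNIV - cball 0 R) f) \<longlongrightarrow> 0) at_top)
       \<and> (((\<lambda>R. bmo_norm (UNIV - cball 0 R) f) \<longlongrightarrow> 0) at_top \<longleftrightarrow> (gamma f \<longlongrightarrow> 0) at_top)
       \<and> ((gamma f \<longlongrightarrow> 0) at_top \<longleftrightarrow> (gamma_weighted f \<longlongrightarrow> 0) at_top)"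
proof -
  have f: "locally_integrable f" using assms by (simp add: bmo_UNIV_iff)
  have ii_iii: "(gamma f \<longlongrightarrow> 0) at_top"
    if "((\<lambda>R. bmo_norm (UNIV - cball 0 R) f) \<longlongrightarrow> 0) at_top"
    by (rule tendsto_0_le[OF that gamma_le_bmo_norm])
  have iv_iii: "(gamma f \<longlongrightarrow> 0) at_top" if "(gamma_weighted f \<longlongrightarrow> 0) at_top"
    by (rule tendsto_0_le[OF that gamma_le_gamma_weighted])
  \<comment> \<open>The implications run (i) to (ii) to (iii) to (i), together with (iii) to (ii)
    and both directions between (iii) and (iv).\<close>
  show ?thesis
    using bmo_closure_bmo_c_tendsto_0 ii_iii iv_iii bmo_closure_bmo_cI[OF assms]
      bmo_norm_outside_tendsto_0[OF f] gamma_weighted_tendsto_0[OF f] by blast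
qed

end
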